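(* Let $n\ge 2$ be an integer and let $\mathfrak{A}$ be a $2$-torsion free unital ring with a nontrivial idempotent $e_1$; put $e_2=1-e_1$. Assume that for all $t\in\mathfrak{A}$: (i) if $e_1te_1\cdot e_1\mathfrak{A}e_2=\{0\}=e_2\mathfrak{A}e_1\cdot e_1te_1$, then $e_1te_1=0$; and (ii) if $e_1\mathfrak{A}e_2\cdot e_2te_2=\{0\}=e_2te_2\cdot e_2\mathfrak{A}e_1$, then $e_2te_2=0$. Then for every multiplicative Jordan $n$-centralizer $\Phi:\mathfrak{A}\rightarrow\mathfrak{A}$ there exists $\mu\in\mathcal{Z}(\mathfrak{A})$ such that $\Phi(t)=\mu t$ for all $t\in\mathfrak{A}$.
   Context: Rings are associative with identity; $\mathcal{Z}(\mathfrak{A})$ is the center of $\mathfrak{A}$. A ring is $2$-torsion free if $2t=0$ implies $t=0$. An idempotent is nontrivial if it is different from $0$ and $1$. The Jordan product is $t_1\circ t_2=t_1t_2+t_2t_1$. Set $q_1(t_1)=t_1$ and $q_n(t_1,\ldots,t_n)=q_{n-1}(t_1,\ldots,t_{n-1})\circ t_n$ for $n\ge 2$. A map $\Phi:\mathfrak{A}\to\mathfrak{A}$ (not assumed additive) is a multiplicative Jordan $n$-centralizer if $\Phi(q_n(t_1,t_2,\ldots,t_n))=q_n(\Phi(t_1),t_2,\ldots,t_n)$ for all $t_1,\ldots,t_n\in\mathfrak{A}$. *)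

theory Defs
  imports Main
begin

definition ring_center :: "'a::ring_1 set" where
  "ring_center = {z. \<forall>x. z * x = x * z}"

definition jordan_prod :: "'a::ring_1 \<Rightarrow> 'a \<Rightarrow> 'a" where
  "jordan_prod s t = s * t + t * s"

text \<open>
  A tuple (t_1, ..., t_n) is given by a function on the naturals of which only the values at
  1, ..., n are used. The value for n = 0 is a dummy.
\<close>

fun jordan_q :: "nat \<Rightarrow> (nat \<Rightarrow> 'a::ring_1) \<Rightarrow> 'a" where
  "jordan_q 0 t = 0"
| "jordan_q (Suc 0) t = t 1"
| "jordan_q (Suc (Suc m)) t = jordan_prod (jordan_q (Suc m) t) (t (Suc (Suc m)))"

definition mult_jordan_centralizer :: "nat \<Rightarrow> ('a::ring_1 \<Rightarrow> 'a) \<Rightarrow> bool" where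
  "mult_jordan_centralizer n \<Phi> \<longleftrightarrow>
     (\<forall>t. \<Phi> (jordan_q n t) = jordan_q n (t(1 := \<Phi> (t 1))))"

definition peirce :: "'a::ring_1 \<Rightarrow> 'a \<Rightarrow> 'a set" where
  "peirce e f = {e * x * f |x. True}"

end

theory Submission
  imports Defs
begin

text \<open>
  Write \<open>C = \<Phi> 1\<close> and \<open>x \<circ> y = x y + y x\<close>. Filling all but two slots of the \<open>n\<close>-fold product
  with \<open>1\<close> gives \<open>\<Phi> (2 ^ (n - 2) (x \<circ> y)) = 2 ^ (n - 2) (\<Phi> x \<circ> y)\<close>. Comparing the substitutions
  \<open>y = 1\<close> and \<open>x = 1\<close> yields \<open>2 \<Phi> y = C \<circ> y\<close>
  (\<open>centralizer_doubled\<close>): although \<open>\<Phi>\<close> is not assumed additive, it is forced to be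
  half of a Jordan multiplication. It follows that \<open>\<Phi>\<close> commutes with multiplication by powers
  of \<open>2\<close>, hence \<open>\<Phi> (x \<circ> y) = \<Phi> x \<circ> y\<close>, that is, \<open>C \<circ> (x \<circ> y) = (C \<circ> x) \<circ> y\<close>.
  The difference of the two sides is the double commutator \<open>[x, [C, y]]\<close>, so every commutator
  with \<open>C\<close> is central (\<open>jordan_associative_imp_commutator_central\<close>).

  It remains to upgrade this to centrality of \<open>C\<close> itself. A central commutator \<open>[C, e]\<close> with an
  idempotent vanishes, so \<open>C\<close> respects the Peirce decomposition. The commutator with an
  element of an off-diagonal Peirce space then stays in that space, where the only central
  element is \<open>0\<close>. Finally, the commutator with an element of a diagonal Peirce space annihilates
  the off-diagonal ones, and the faithfulness conditions (i), (ii) make it vanish.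
  Once \<open>C\<close> is central, \<open>2 \<Phi> t = C \<circ> t = 2 C t\<close> gives the result with \<open>\<mu> = C\<close>.
\<close>

lemma two_power_torsion_free:
  fixes x y :: "'a::ring_1"
  assumes two_torsion_free: "\<forall>t::'a. 2 * t = 0 \<longrightarrow> t = 0"
    and "2 ^ k * x = 2 ^ k * y"
  shows "x = y"
  using assms(2)
proof (induction k)
  case 0
  then show ?case by simp
next
  case (Suc k)
  have "2 * (2 ^ k * x - 2 ^ k * y) = 0"
    using Suc.prems by (simp add: right_diff_distrib mult.assoc)
  then have "2 ^ k * x - 2 ^ k * y = 0" using two_torsion_free by blast
  then show ?case using Suc.IH by simp
qed

lemma jordan_q_pad_ones:
  fixes x y :: "'a::ring_1"
  assumes "t 1 = x" "t 2 = y" "\<And>i. i > 2 \<Longrightarrow> t i = 1"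
  shows "jordan_q (Suc (Suc k)) t = 2 ^ k * jordan_prod x y"
proof (induction k)
  case 0
  then show ?case using assms by (simp add: numeral_2_eq_2)
next
  case (Suc k)
  have "jordan_q (Suc (Suc (Suc k))) t = jordan_prod (jordan_q (Suc (Suc k)) t) 1"
    using assms(3)[of "Suc (Suc (Suc k))"] by simp
  also have "\<dots> = 2 * jordan_q (Suc (Suc k)) t"
    by (simp add: jordan_prod_def mult_2)
  finally show ?case unfolding Suc.IH by (simp add: mult.assoc)
qed

lemma centralizer_two_slots:
  fixes x y :: "'a::ring_1"
  assumes "mult_jordan_centralizer (Suc (Suc k)) \<Phi>"
  shows "\<Phi> (2 ^ k * jordan_prod x y) = 2 ^ k * jordan_prod (\<Phi> x) y"
proof -
  define t :: "nat \<Rightarrow> 'a" where "t = (\<lambda>i. if i = 1 then x else if i = 2 then y else 1)"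
  have "\<Phi> (jordan_q (Suc (Suc k)) t) = jordan_q (Suc (Suc k)) (t(1 := \<Phi> (t 1)))"
    using assms unfolding mult_jordan_centralizer_def by blast
  moreover have "jordan_q (Suc (Suc k)) t = 2 ^ k * jordan_prod x y"
    by (rule jordan_q_pad_ones) (auto simp: t_def)
  moreover have "jordan_q (Suc (Suc k)) (t(1 := \<Phi> (t 1))) = 2 ^ k * jordan_prod (\<Phi> x) y"
    by (rule jordan_q_pad_ones) (auto simp: t_def)
  ultimately show ?thesis by simp
qed

text \<open>
  The element \<open>2 ^ (k + 1) y\<close> equals both \<open>2 ^ k (y \<circ> 1)\<close> and \<open>2 ^ k (1 \<circ> y)\<close>; the first form lets
  the scalar pass through \<open>\<Phi>\<close>, the second brings in \<open>\<Phi> 1\<close>.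
\<close>
lemma centralizer_doubled:
  fixes y :: "'a::ring_1"
  assumes two_torsion_free: "\<forall>t::'a. 2 * t = 0 \<longrightarrow> t = 0"
    and \<Phi>: "mult_jordan_centralizer (Suc (Suc k)) \<Phi>"
  shows "2 * \<Phi> y = jordan_prod (\<Phi> 1) y"
proof -
  have "2 ^ k * jordan_prod (\<Phi> y) 1 = 2 ^ k * jordan_prod (\<Phi> 1) y"
    using centralizer_two_slots[OF \<Phi>, of y 1] centralizer_two_slots[OF \<Phi>, of 1 y]
    by (simp add: jordan_prod_def)
  then have "jordan_prod (\<Phi> y) 1 = jordan_prod (\<Phi> 1) y"
    by (rule two_power_torsion_free[OF two_torsion_free])
  then show ?thesis by (simp add: jordan_prod_def mult_2)
qed

lemma two_power_commute: "2 ^ k * (x::'a::ring_1) = x * 2 ^ k"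
  by (induction k) (simp_all add: mult.assoc mult_2 mult_2_right distrib_left distrib_right)

lemma jordan_prod_scale_right:
  "jordan_prod (c::'a::ring_1) (2 ^ k * x) = 2 ^ k * jordan_prod c x"
proof -
  have "c * (2 ^ k * x) = 2 ^ k * (c * x)"
    by (metis mult.assoc two_power_commute)
  then show ?thesis by (simp add: jordan_prod_def distrib_left mult.assoc)
qed

text \<open>
  By the formula for \<open>2 \<Phi>\<close>, the factor \<open>2 ^ k\<close> in the two-slot identity can be pulled out of
  \<open>\<Phi>\<close> and cancelled; doubling what remains eliminates \<open>\<Phi>\<close> in favour of \<open>\<Phi> 1\<close>.
\<close>
lemma centralizer_jordan_associative:
  fixes x y :: "'a::ring_1"
  assumes two_torsion_free: "\<forall>t::'a. 2 * t = 0 \<longrightarrow> t = 0"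
    and \<Phi>: "mult_jordan_centralizer (Suc (Suc k)) \<Phi>"
  shows "jordan_prod (\<Phi> 1) (jordan_prod x y) = jordan_prod (jordan_prod (\<Phi> 1) x) y"
proof -
  note doubled = centralizer_doubled[OF two_torsion_free \<Phi>]
  have "2 ^ k * jordan_prod (\<Phi> 1) (jordan_prod x y)
      = jordan_prod (\<Phi> 1) (2 ^ k * jordan_prod x y)"
    by (simp add: jordan_prod_scale_right)
  also have "\<dots> = 2 * \<Phi> (2 ^ k * jordan_prod x y)"
    by (simp add: doubled)
  also have "\<dots> = 2 ^ k * (2 * jordan_prod (\<Phi> x) y)"
    by (simp add: centralizer_two_slots[OF \<Phi>] mult_2 distrib_left)
  also have "2 * jordan_prod (\<Phi> x) y = jordan_prod (2 * \<Phi> x) y"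
    by (simp add: jordan_prod_def mult_2 distrib_left distrib_right)
  also have "\<dots> = jordan_prod (jordan_prod (\<Phi> 1) x) y"
    by (simp add: doubled)
  finally show ?thesis by (rule two_power_torsion_free[OF two_torsion_free])
qed

text \<open>
  The Jordan associator is a double commutator:
  \<open>(C \<circ> x) \<circ> y - C \<circ> (x \<circ> y) = x C y + y C x - C y x - x y C = [x, [C, y]]\<close>.
\<close>
lemma jordan_associative_imp_commutator_central:
  fixes C :: "'a::ring_1"
  assumes "\<And>x y. jordan_prod C (jordan_prod x y) = jordan_prod (jordan_prod C x) y"
  shows "C * y - y * C \<in> ring_center"
  unfolding ring_center_def
proof (intro CollectI allI)
  fix x
  have "x * (C * y - y * C) - (C * y - y * C) * x
      = jordan_prod (jordan_prod C x) y - jordan_prod C (jordan_prod x y)"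
    by (simp add: jordan_prod_def algebra_simps)
  then show "(C * y - y * C) * x = x * (C * y - y * C)"
    using assms[of x y] by simp
qed

text \<open>
  For \<open>z = [C, e]\<close>, the Leibniz rule applied to \<open>e = e e\<close> gives \<open>z = z e + e z = 2 e z\<close>.
  Multiplying by \<open>e\<close> yields \<open>e z = 2 e z\<close>, so \<open>e z = 0\<close> and thus \<open>z = 0\<close>.
\<close>
lemma central_commutator_idempotent:
  fixes C e :: "'a::ring_1"
  assumes idem: "e * e = e"
    and central: "C * e - e * C \<in> ring_center"
  shows "C * e = e * C"
proof -
  define z where "z = C * e - e * C"
  have comm: "z * e = e * z"
    using central by (simp add: ring_center_def z_def)
  have ee: "e * (e * a) = e * a" for a
    by (simp add: idem flip: mult.assoc)
  have leibniz: "z = z * e + e * z"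
    by (simp add: z_def algebra_simps ee idem)
  then have z: "z = e * z + e * z" by (simp add: comm)
  then have "e * z = e * (e * z + e * z)" by simp
  then have "e * z = 0" by (simp add: distrib_left ee)
  then show ?thesis using z by (simp add: z_def)
qed

text \<open>
  The commutator \<open>w\<close> of \<open>C\<close> with \<open>e x f\<close> satisfies \<open>e w = w\<close> and \<open>w e = 0\<close>, which is incompatible
  with \<open>w\<close> being central unless \<open>w = 0\<close>.
\<close>
lemma central_commutator_off_diagonal:
  fixes C e f :: "'a::ring_1"
  assumes idem: "e * e = e" and orth: "f * e = 0"
    and comm: "C * e = e * C"
    and central: "\<And>y. C * y - y * C \<in> ring_center"
  shows "C * (e * x * f) = e * x * f * C"
proof -
  define w where "w = C * (e * x * f) - e * x * f * C"
  have Ce: "C * (e * a) = e * (C * a)" for a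
    by (simp add: comm flip: mult.assoc)
  have ee: "e * (e * a) = e * a" for a
    by (simp add: idem flip: mult.assoc)
  have "e * w = w"
    by (simp add: w_def right_diff_distrib mult.assoc Ce ee)
  moreover have "w * e = 0"
    by (simp add: w_def left_diff_distrib mult.assoc comm orth)
      (simp add: orth flip: mult.assoc)
  moreover have "w * e = e * w"
    using central[of "e * x * f"] by (simp add: ring_center_def w_def)
  ultimately show ?thesis by (simp add: w_def)
qed

text \<open>
  The commutator \<open>w\<close> of \<open>C\<close> with \<open>a = e y e\<close> lies in the \<open>e\<close>-corner. For \<open>x\<close> in the Peirce space
  \<open>e A f\<close>, both \<open>x\<close> and \<open>a x\<close> commute with \<open>C\<close>, whence \<open>w x = C a x - a x C = 0\<close>; the other side is
  dual. Faithfulness of the corner on the two off-diagonal spaces gives \<open>w = 0\<close>. The lemma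
  is stated for an arbitrary pair \<open>e, f\<close> so that it serves both corners.
\<close>
lemma commutes_with_corner:
  fixes C e f :: "'a::ring_1"
  assumes idem: "e * e = e" and comm: "C * e = e * C"
    and ef: "\<And>x. C * (e * x * f) = e * x * f * C"
    and fe: "\<And>x. C * (f * x * e) = f * x * e * C"
    and faithful: "\<And>t. (\<lambda>x. (e * t * e) * x) ` peirce e f = {0} \<Longrightarrow>
                 (\<lambda>x. x * (e * t * e)) ` peirce f e = {0} \<Longrightarrow> e * t * e = 0"
  shows "C * (e * y * e) = e * y * e * C"
proof -
  define w where "w = C * (e * y * e) - e * y * e * C"
  have Ce: "C * (e * a) = e * (C * a)" for a
    by (simp add: comm flip: mult.assoc)
  have ee: "e * (e * a) = e * a" for a
    by (simp add: idem flip: mult.assoc)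
  have corner: "e * w * e = w"
    by (simp add: w_def right_diff_distrib left_diff_distrib mult.assoc Ce ee idem comm)
  have left: "w * (e * x * f) = 0" for x
  proof -
    have "w * (e * x * f) = C * (e * (y * e * x) * f) - e * y * e * (C * (e * x * f))"
      by (simp add: w_def left_diff_distrib mult.assoc ee)
    also have "\<dots> = 0"
      unfolding ef by (simp add: mult.assoc ee)
    finally show ?thesis .
  qed
  have right: "(f * x * e) * w = 0" for x
  proof -
    have "(f * x * e) * w = f * x * e * C * (e * y * e) - f * (x * e * y) * e * C"
      by (simp add: w_def right_diff_distrib mult.assoc ee)
    also have "\<dots> = 0"
      unfolding fe[symmetric] by (simp add: mult.assoc ee)
    finally show ?thesis .
  qed
  \<comment> \<open>Nonemptiness of the Peirce spaces makes the images below \<open>{0}\<close> and not \<open>{}\<close>.\<close>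
  have zero: "0 \<in> peirce e' f'" for e' f' :: 'a
    unfolding peirce_def by (auto intro: exI[of _ 0])
  have "(\<lambda>x. (e * w * e) * x) ` peirce e f = {0}"
    unfolding corner using left zero[of e f] by (force simp: peirce_def)
  moreover have "(\<lambda>x. x * (e * w * e)) ` peirce f e = {0}"
    unfolding corner using right zero[of f e] by (force simp: peirce_def)
  ultimately have "e * w * e = 0" by (rule faithful)
  then have "w = 0" unfolding corner .
  then show ?thesis by (simp add: w_def)
qed

theorem proposition3p1:
  fixes n :: nat
    and e1 e2 :: "'a::ring_1"
    and \<Phi> :: "'a \<Rightarrow> 'a"
  assumes "n \<ge> 2"
    and two_torsion_free: "\<And>t::'a. 2 * t = 0 \<Longrightarrow> t = 0"
    and idempotent: "e1 * e1 = e1"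
    and nontrivial: "e1 \<noteq> 0" "e1 \<noteq> 1"
    and e2: "e2 = 1 - e1"
    and i: "\<And>t. (\<lambda>x. (e1 * t * e1) * x) ` peirce e1 e2 = {0} \<Longrightarrow>
                 (\<lambda>x. x * (e1 * t * e1)) ` peirce e2 e1 = {0} \<Longrightarrow> e1 * t * e1 = 0"
    and ii: "\<And>t. (\<lambda>x. x * (e2 * t * e2)) ` peirce e1 e2 = {0} \<Longrightarrow>
                  (\<lambda>x. (e2 * t * e2) * x) ` peirce e2 e1 = {0} \<Longrightarrow> e2 * t * e2 = 0"
    and "mult_jordan_centralizer n \<Phi>"
  shows "\<exists>\<mu>\<in>ring_center. \<forall>t. \<Phi> t = \<mu> * t"
proof -
  define C where "C = \<Phi> 1"
  obtain k where n: "n = Suc (Suc k)"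
    using \<open>n \<ge> 2\<close> by (metis add_2_eq_Suc le_Suc_ex)
  have \<Phi>: "mult_jordan_centralizer (Suc (Suc k)) \<Phi>"
    using \<open>mult_jordan_centralizer n \<Phi>\<close> n by simp
  have tf: "\<forall>t::'a. 2 * t = 0 \<longrightarrow> t = 0"
    using two_torsion_free by blast
  have central: "C * y - y * C \<in> ring_center" for y
    unfolding C_def
    using centralizer_jordan_associative[OF tf \<Phi>]
    by (rule jordan_associative_imp_commutator_central)
  have idem2: "e2 * e2 = e2" and orth12: "e1 * e2 = 0" and orth21: "e2 * e1 = 0"
    by (simp_all add: e2 algebra_simps idempotent)
  have comm1: "C * e1 = e1 * C"
    by (rule central_commutator_idempotent[OF idempotent central])
  have comm2: "C * e2 = e2 * C"
    by (rule central_commutator_idempotent[OF idem2 central])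
  have c12: "C * (e1 * x * e2) = e1 * x * e2 * C" for x
    by (rule central_commutator_off_diagonal[OF idempotent orth21 comm1 central])
  have c21: "C * (e2 * x * e1) = e2 * x * e1 * C" for x
    by (rule central_commutator_off_diagonal[OF idem2 orth12 comm2 central])
  have c11: "C * (e1 * x * e1) = e1 * x * e1 * C" for x
    by (rule commutes_with_corner[OF idempotent comm1 c12 c21 i])
  have c22: "C * (e2 * x * e2) = e2 * x * e2 * C" for x
    by (rule commutes_with_corner[OF idem2 comm2 c21 c12 ii])
  have C_comm: "C * x = x * C" for x
  proof -
    have x: "x = e1 * x * e1 + e1 * x * e2 + e2 * x * e1 + e2 * x * e2"
      by (simp add: e2 algebra_simps)
    have "C * (e1 * x * e1 + e1 * x * e2 + e2 * x * e1 + e2 * x * e2)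
        = (e1 * x * e1 + e1 * x * e2 + e2 * x * e1 + e2 * x * e2) * C"
      by (simp only: distrib_left distrib_right c11 c12 c21 c22)
    then show ?thesis using x by simp
  qed
  have "\<Phi> t = C * t" for t
  proof -
    have "2 * \<Phi> t = 2 * (C * t)"
      using centralizer_doubled[OF tf \<Phi>, of t]
      by (simp add: jordan_prod_def mult_2 C_comm flip: C_def)
    then have "2 * (\<Phi> t - C * t) = 0" by (simp add: right_diff_distrib)
    then show ?thesis using two_torsion_free by fastforce
  qed
  moreover have "C \<in> ring_center"
    using C_comm by (simp add: ring_center_def)
  ultimately show ?thesis by blast
qed

end
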